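(* Fix a constant $\overline{\gamma}<1/2$. Let $A\in\mathbb{Q}^{n\times n}$ be nonsingular with $\|A^{-1}\|_1\le\overline{\gamma}$, let $b\in\mathbb{Q}^n$, write $A=\bar A/d_A$, $b=\bar b/d_b$ with $\bar A\in\mathbb{Z}^{n\times n}$, $\bar b\in\mathbb{Z}^n$, $d_A,d_b\in\mathbb{Z}_{>0}$, and let $L=\max\{d_b,d_A,\|\bar b\|_\infty,\|\bar A\|_{\max}\}$. Then: (i) Starting from any initial vector, the generalized Newton method (GNM) terminates at the unique solution of the absolute value equation $Ax-|x|=b$ in $\mathcal{O}(n\log(nL))$ iterations. (ii) Starting from any initial sign vector, the sign-flip algorithm equipped with either the Gauss--Southwell or the steepest single-flip rule reaches a global maximizer $z^*$ over $\{-1,1\}^n$ of $F(z)=z^T(A-\operatorname{Diag}(z))^{-1}b$ within $\mathcal{O}(n^2\log(nL))$ iterations.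
   Context: $\|\cdot\|_1$ for matrices is the maximum absolute column sum; $\|\cdot\|_\infty$ for vectors is the maximum absolute entry; $\|X\|_{\max}=\max_{i,j}|X_{ij}|$. For $z\in\{-1,1\}^n$ write $Z=\operatorname{Diag}(z)$; $A-Z$ is nonsingular for all such $z$ under the stated condition. Sign-flip algorithm for $Ax-|x|=b$: initialize $z\in\{-1,1\}^n$; compute $x=(A-Z)^{-1}b$ and the mismatch set $\mathcal{V}_z=\{i\in[n]: z_ix_i<0\}$, where $[n]=\{1,\dots,n\}$. While $\mathcal{V}_z\neq\emptyset$: select a nonempty subset $S\subseteq\mathcal{V}_z$ by some rule; replace $z_i$ by $-z_i$ for $i\in S$; recompute $Z$, $x=(A-Z)^{-1}b$ and $\mathcal{V}_z$. When $\mathcal{V}_z=\emptyset$, return $x$. One pass through the while loop is one iteration. Selection rules, with $H=(A-Z)^{-1}$, $x=Hb$, $y=H^Tz$: - GNM (full-flip rule): $S=\mathcal{V}_z$. The initial vector is a sign vector $z\in\{-1,1\}^n$. Equivalently, $z_i$ is replaced by $\operatorname{sgn}(x_i)$ if $x_i\ne0$ and kept if $x_i=0$. - Gauss--Southwell single-flip rule: $S=\{k^*\}$ with $k^*\in\arg\max_{i\in\mathcal{V}_z}|x_i|$. - Steepest single-flip rule: $S=\{k^*\}$ with $k^*\in\arg\max_{i\in\mathcal{V}_z}\Delta F_i$, where $\Delta F_i=\frac{-2z_ix_i(1+y_i)}{1+2z_iH_{ii}}$ is the change of $F$ caused by flipping the sign of coordinate $i$. The constants implied by $\mathcal{O}$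 depend only on the fixed constant $\overline{\gamma}$. *)

theory Defs
  imports Complex_Main "Jordan_Normal_Form.Gauss_Jordan_Elimination"
begin

definition mat_inv :: "real mat \<Rightarrow> real mat" where
  "mat_inv M = the (mat_inverse M)"

text \<open>The norms below are meant for positive dimensions only.\<close>

definition mat_one_norm :: "real mat \<Rightarrow> real" where
  "mat_one_norm M = Max ((\<lambda>j. \<Sum>i<dim_row M. \<bar>M $$ (i, j)\<bar>) ` {..<dim_col M})"

definition vec_inf_norm :: "'a :: linordered_idom vec \<Rightarrow> 'a" where
  "vec_inf_norm v = Max ((\<lambda>i. \<bar>v $ i\<bar>) ` {..<dim_vec v})"

definition mat_max_norm :: "'a :: linordered_idom mat \<Rightarrow> 'a" where
  "mat_max_norm M = Max ((\<lambda>(i, j). \<bar>M $$ (i, j)\<bar>) ` ({..<dim_row M} \<times> {..<dim_col M}))"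

definition sign_vecs :: "nat \<Rightarrow> real vec set" where
  "sign_vecs n = {z \<in> carrier_vec n. \<forall>i<n. z $ i \<in> {-1, 1}}"

definition Diag :: "real vec \<Rightarrow> real mat" where
  "Diag z = mat_diag (dim_vec z) (\<lambda>i. z $ i)"

definition ave_solution :: "real mat \<Rightarrow> real vec \<Rightarrow> real vec \<Rightarrow> bool" where
  "ave_solution A b x \<longleftrightarrow>
     x \<in> carrier_vec (dim_col A) \<and> A *\<^sub>v x - map_vec abs x = b"

definition sf_H :: "real mat \<Rightarrow> real vec \<Rightarrow> real mat" where
  "sf_H A z = mat_inv (A - Diag z)"

definition sf_x :: "real mat \<Rightarrow> real vec \<Rightarrow> real vec \<Rightarrow> real vec" where
  "sf_x A b z = sf_H A z *\<^sub>v b"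

definition sf_y :: "real mat \<Rightarrow> real vec \<Rightarrow> real vec" where
  "sf_y A z = transpose_mat (sf_H A z) *\<^sub>v z"

definition sf_F :: "real mat \<Rightarrow> real vec \<Rightarrow> real vec \<Rightarrow> real" where
  "sf_F A b z = z \<bullet> (mat_inv (A - Diag z) *\<^sub>v b)"

definition is_global_max :: "nat \<Rightarrow> (real vec \<Rightarrow> real) \<Rightarrow> real vec \<Rightarrow> bool" where
  "is_global_max n f z \<longleftrightarrow> z \<in> sign_vecs n \<and> (\<forall>w \<in> sign_vecs n. f w \<le> f z)"

definition mismatch :: "real mat \<Rightarrow> real vec \<Rightarrow> real vec \<Rightarrow> nat set" where
  "mismatch A b z = {i. i < dim_vec z \<and> z $ i * sf_x A b z $ i < 0}"

definition flip :: "nat set \<Rightarrow> real vec \<Rightarrow> real vec" where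
  "flip S z = vec (dim_vec z) (\<lambda>i. if i \<in> S then - (z $ i) else z $ i)"

text \<open>A selection rule specifies which sets may be flipped at the current sign vector.
  Rules are relations rather than functions, since ties in an argmax may be broken
  arbitrarily.\<close>

type_synonym selection_rule = "real mat \<Rightarrow> real vec \<Rightarrow> real vec \<Rightarrow> nat set \<Rightarrow> bool"

definition full_flip :: selection_rule where
  "full_flip A b z S \<longleftrightarrow> S = mismatch A b z"

definition gauss_southwell :: selection_rule where
  "gauss_southwell A b z S \<longleftrightarrow>
     (\<exists>k. S = {k} \<and> is_arg_max (\<lambda>i. \<bar>sf_x A b z $ i\<bar>) (\<lambda>i. i \<in> mismatch A b z) k)"

definition delta_F :: "real mat \<Rightarrow> real vec \<Rightarrow> real vec \<Rightarrow> nat \<Rightarrow> real" where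
  "delta_F A b z i =
     (- 2 * z $ i * sf_x A b z $ i * (1 + sf_y A z $ i)) / (1 + 2 * z $ i * sf_H A z $$ (i, i))"

definition steepest :: selection_rule where
  "steepest A b z S \<longleftrightarrow>
     (\<exists>k. S = {k} \<and> is_arg_max (delta_F A b z) (\<lambda>i. i \<in> mismatch A b z) k)"

definition flip_step ::
  "selection_rule \<Rightarrow> real mat \<Rightarrow> real vec \<Rightarrow> real vec \<Rightarrow> real vec \<Rightarrow> bool" where
  "flip_step rule A b z z' \<longleftrightarrow>
     (\<exists>S. S \<noteq> {} \<and> S \<subseteq> mismatch A b z \<and> rule A b z S \<and> z' = flip S z)"

text \<open>Every execution from \<open>z0\<close>, however ties are broken, takes at most \<open>N\<close> iterations,
  never gets stuck while mismatches remain, and ends in a sign vector satisfying \<open>P\<close>.\<close>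

definition terminates_within ::
  "selection_rule \<Rightarrow> real mat \<Rightarrow> real vec \<Rightarrow> real vec \<Rightarrow> real \<Rightarrow> (real vec \<Rightarrow> bool) \<Rightarrow> bool" where
  "terminates_within rule A b z0 N P \<longleftrightarrow>
     (\<forall>k z. (flip_step rule A b ^^ k) z0 z \<longrightarrow>
        real k \<le> N \<and>
        (if mismatch A b z = {} then P z else (\<exists>z'. flip_step rule A b z z')))"

end

theory Submission
  imports Defs "Jordan_Normal_Form.Determinant"
begin

text \<open>
  Put \<open>\<eta> = \<gamma> / (1 - \<gamma>) < 1\<close>. Since \<open>A v = Z v + (A - Z) v\<close>, the bound on \<open>A\<^sup>-\<^sup>1\<close> gives
  \<open>\<parallel>(A - Z)\<^sup>-\<^sup>1\<parallel>\<^sub>1 \<le> \<eta>\<close>, so all entries of \<open>y(z)\<close> have modulus at most \<open>\<eta>\<close>. The identity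
  \<open>F(w) - F(z) = (\<Sum>i. (1 + y(w)\<^sub>i) (w\<^sub>i - z\<^sub>i) x(z)\<^sub>i)\<close> then bounds the gain of a flip of \<open>S\<close> below by
  \<open>2 (1 - \<eta>)\<close> times the sum of \<open>\<bar>x\<^sub>i\<bar>\<close> over \<open>S\<close>, and every optimality gap above by
  \<open>2 (1 + \<eta>)\<close> times the sum of \<open>\<bar>x\<^sub>i\<bar>\<close> over the mismatch set. With \<open>m = 1\<close> for full flips and \<open>m = n\<close> for
  single flips, the gap therefore shrinks by the factor \<open>1 - (1 - 2\<gamma>) / m\<close> in each iteration,
  while by Cramer's rule a nonzero \<open>x\<^sub>i\<close> has modulus at least \<open>1 / (L n! (2 L)\<^sup>n)\<close>.
\<close>

section \<open>The 1-norm of vectors and its compatibility with \<open>mat_one_norm\<close>\<close>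

definition vec_one_norm :: "real vec \<Rightarrow> real" where
  "vec_one_norm v = (\<Sum>i<dim_vec v. \<bar>v $ i\<bar>)"

lemma vec_one_norm_nonneg: "0 \<le> vec_one_norm v"
  by (simp add: vec_one_norm_def sum_nonneg)

lemma vec_one_norm_zeroD:
  assumes "vec_one_norm v = 0" "v \<in> carrier_vec n"
  shows "v = 0\<^sub>v n"
proof (rule eq_vecI)
  fix i assume "i < dim_vec (0\<^sub>v n :: real vec)"
  hence "i < dim_vec v" using assms(2) by auto
  hence "\<bar>v $ i\<bar> = 0"
    using assms(1) sum_nonneg_eq_0_iff[of "{..<dim_vec v}" "\<lambda>i. \<bar>v $ i\<bar>"]
    by (simp add: vec_one_norm_def)
  thus "v $ i = 0\<^sub>v n $ i" using assms(2) \<open>i < dim_vec v\<close> by simp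
qed (use assms(2) in simp)

lemma index_mult_mat_vec_sum:
  assumes "M \<in> carrier_mat nr nc" "v \<in> carrier_vec nc" "i < nr"
  shows "(M *\<^sub>v v) $ i = (\<Sum>j<nc. M $$ (i, j) * v $ j)"
  using assms by (auto simp: scalar_prod_def lessThan_atLeast0)

lemma col_sum_le_mat_one_norm:
  assumes "M \<in> carrier_mat nr nc" "j < nc"
  shows "(\<Sum>i<nr. \<bar>M $$ (i, j)\<bar>) \<le> mat_one_norm M"
  unfolding mat_one_norm_def using assms by (intro Max_ge) auto

lemma vec_one_norm_mult_le:
  assumes M: "M \<in> carrier_mat nr nc" and v: "v \<in> carrier_vec nc"
  shows "vec_one_norm (M *\<^sub>v v) \<le> mat_one_norm M * vec_one_norm v"
proof -
  have "vec_one_norm (M *\<^sub>v v) = (\<Sum>i<nr. \<bar>\<Sum>j<nc. M $$ (i, j) * v $ j\<bar>)"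
    unfolding vec_one_norm_def using M
    by (intro sum.cong) (auto simp: index_mult_mat_vec_sum[OF M v] simp del: index_mult_mat_vec)
  also have "\<dots> \<le> (\<Sum>i<nr. \<Sum>j<nc. \<bar>M $$ (i, j)\<bar> * \<bar>v $ j\<bar>)"
    by (intro sum_mono order.trans[OF sum_abs]) (simp add: abs_mult)
  also have "\<dots> = (\<Sum>j<nc. (\<Sum>i<nr. \<bar>M $$ (i, j)\<bar>) * \<bar>v $ j\<bar>)"
    by (subst sum.swap) (simp add: sum_distrib_right)
  also have "\<dots> \<le> (\<Sum>j<nc. mat_one_norm M * \<bar>v $ j\<bar>)"
    using col_sum_le_mat_one_norm[OF M] by (intro sum_mono mult_right_mono) auto
  also have "\<dots> = mat_one_norm M * vec_one_norm v"
    using v by (simp add: vec_one_norm_def sum_distrib_left)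
  finally show ?thesis .
qed

section \<open>Inverses through determinants\<close>

lemma invertible_mat_imp_det_nonzero:
  fixes M :: "'a :: idom mat"
  assumes M: "M \<in> carrier_mat n n" and inv: "invertible_mat M"
  shows "det M \<noteq> 0"
proof -
  obtain B where 1: "M * B = 1\<^sub>m n" and 2: "B * M = 1\<^sub>m (dim_row B)"
    using inv M unfolding invertible_mat_def inverts_mat_def by auto
  \<comment> \<open>\<open>invertible_mat\<close> does not fix the dimensions of the inverse;
    comparing column counts in the two equations does.\<close>
  have "B \<in> carrier_mat n n"
    using arg_cong[OF 1, of dim_col] arg_cong[OF 2, of dim_col] M by auto
  from det_mult[OF M this] show ?thesis using 1 by auto
qed

lemma mat_inv:
  assumes M: "M \<in> carrier_mat n n" and "det M \<noteq> 0"
  shows "mat_inv M \<in> carrier_mat n n" "M * mat_inv M = 1\<^sub>m n" "mat_inv M * M = 1\<^sub>m n"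
proof -
  obtain B where "mat_inverse M = Some B"
    \<comment> \<open>\<open>mat_inverse\<close> fails only on non-units of the matrix ring. The
      value \<open>()\<close> fills the extension slot of the ring record.\<close>
    using mat_inverse(1)[OF M, where b = "()"] det_non_zero_imp_unit[OF assms, where b = "()"] by (cases "mat_inverse M") auto
  with mat_inverse(2)[OF M this]
  show "mat_inv M \<in> carrier_mat n n" "M * mat_inv M = 1\<^sub>m n" "mat_inv M * M = 1\<^sub>m n"
    by (auto simp: mat_inv_def)
qed

lemma mult_mat_inv_vec:
  assumes M: "M \<in> carrier_mat n n" "det M \<noteq> 0" and v: "v \<in> carrier_vec n"
  shows "M *\<^sub>v (mat_inv M *\<^sub>v v) = v" "mat_inv M *\<^sub>v (M *\<^sub>v v) = v"
  using mat_inv[OF M] M v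
  by (simp_all flip: assoc_mult_mat_vec[of _ n n _ n])

section \<open>Sign vectors and their diagonal matrices\<close>

lemma Diag_carrier: "z \<in> carrier_vec n \<Longrightarrow> Diag z \<in> carrier_mat n n"
  by (simp add: Diag_def)

lemma Diag_mult_vec_index:
  assumes "z \<in> carrier_vec n" "v \<in> carrier_vec n" "i < n"
  shows "(Diag z *\<^sub>v v) $ i = z $ i * v $ i"
proof -
  have "(Diag z *\<^sub>v v) $ i = (\<Sum>j<n. if j = i then z $ i * v $ i else 0)"
    unfolding index_mult_mat_vec_sum[OF Diag_carrier[OF assms(1)] assms(2,3)]
    using assms by (intro sum.cong) (auto simp: Diag_def mat_diag_def)
  thus ?thesis using assms(3) by simp
qed

lemma sign_vecs_carrier: "z \<in> sign_vecs n \<Longrightarrow> z \<in> carrier_vec n"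
  by (simp add: sign_vecs_def)

lemma sign_vecs_index: "z \<in> sign_vecs n \<Longrightarrow> i < n \<Longrightarrow> z $ i = 1 \<or> z $ i = -1"
  by (auto simp: sign_vecs_def)

lemma sign_vecs_abs_index: "z \<in> sign_vecs n \<Longrightarrow> i < n \<Longrightarrow> \<bar>z $ i\<bar> = 1"
  using sign_vecs_index by fastforce

lemma flip_sign_vecs: "z \<in> sign_vecs n \<Longrightarrow> flip S z \<in> sign_vecs n"
  by (fastforce simp: sign_vecs_def flip_def)

lemma flip_index: "z \<in> carrier_vec n \<Longrightarrow> i < n \<Longrightarrow> flip S z $ i = (if i \<in> S then - z $ i else z $ i)"
  by (auto simp: flip_def)

section \<open>Real data: nonsingularity of \<open>A - Diag z\<close> and bounds on its
  inverse\<close>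

locale ave_small_inverse =
  fixes n :: nat and A :: "real mat" and b :: "real vec" and \<gamma> :: real
  assumes n_pos: "0 < n"
    and A: "A \<in> carrier_mat n n"
    and b: "b \<in> carrier_vec n"
    and inv: "invertible_mat A"
    and norm_le: "mat_one_norm (mat_inv A) \<le> \<gamma>"
    and \<gamma>_less: "\<gamma> < 1 / 2"
begin

text \<open>The solution of \<open>\<eta> = \<gamma> * (1 + \<eta>)\<close>, that is, the sum of the
  geometric series of the positive powers of \<gamma>.\<close>

definition \<eta> :: real where "\<eta> = \<gamma> / (1 - \<gamma>)"

abbreviation "x z \<equiv> sf_x A b z"
abbreviation "y z \<equiv> sf_y A z"
abbreviation "F z \<equiv> sf_F A b z"
abbreviation "V z \<equiv> mismatch A b z"

lemma det_A: "det A \<noteq> 0"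
  using invertible_mat_imp_det_nonzero[OF A inv] .

text \<open>Turns the norm bound on the inverse into a lower bound for \<open>A\<close>, the only
  form in which that bound is used afterwards.\<close>

lemma vec_one_norm_le: "v \<in> carrier_vec n \<Longrightarrow> vec_one_norm v \<le> \<gamma> * vec_one_norm (A *\<^sub>v v)"
proof -
  assume v: "v \<in> carrier_vec n"
  have "vec_one_norm (mat_inv A *\<^sub>v (A *\<^sub>v v)) \<le> mat_one_norm (mat_inv A) * vec_one_norm (A *\<^sub>v v)"
    using mat_inv[OF A det_A] A v by (intro vec_one_norm_mult_le[of _ n n]) auto
  also have "\<dots> \<le> \<gamma> * vec_one_norm (A *\<^sub>v v)"
    using norm_le by (intro mult_right_mono vec_one_norm_nonneg)
  finally show ?thesis using mult_mat_inv_vec[OF A det_A v] by simp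
qed

text \<open>With \<gamma> at most 0, the previous bound would give a unit vector norm 0.\<close>

lemma \<gamma>_pos: "0 < \<gamma>"
proof (rule ccontr)
  assume "\<not> 0 < \<gamma>"
  hence "vec_one_norm (unit_vec n 0) \<le> 0"
    using order.trans[OF vec_one_norm_le[of "unit_vec n 0"]]
    by (simp add: mult_nonpos_nonneg vec_one_norm_nonneg)
  moreover have "vec_one_norm (unit_vec n 0) \<ge> \<bar>unit_vec n 0 $ 0\<bar>"
    unfolding vec_one_norm_def using n_pos by (intro member_le_sum) auto
  ultimately show False using n_pos by simp
qed

lemma \<eta>_bounds: "0 < \<eta>" "\<eta> < 1"
  using \<gamma>_pos \<gamma>_less by (auto simp: \<eta>_def field_simps)

lemma A_minus_Diag_carrier: "z \<in> sign_vecs n \<Longrightarrow> A - Diag z \<in> carrier_mat n n"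
  using A by (auto intro!: minus_carrier_mat Diag_carrier sign_vecs_carrier)

lemma A_minus_Diag_index:
  assumes z: "z \<in> sign_vecs n" and v: "v \<in> carrier_vec n" and i: "i < n"
  shows "((A - Diag z) *\<^sub>v v) $ i = (A *\<^sub>v v) $ i - z $ i * v $ i"
  using minus_mult_distrib_mat_vec[OF A Diag_carrier[OF sign_vecs_carrier[OF z]] v]
    Diag_mult_vec_index[OF sign_vecs_carrier[OF z] v i] i
    Diag_carrier[OF sign_vecs_carrier[OF z]] A
  by (simp del: index_mult_mat_vec)

text \<open>Phrased as a lower bound for the matrix, since this yields both its nonsingularity (a
  kernel vector has norm 0) and the bound on \<open>sf_H\<close>.\<close>

lemma vec_one_norm_le_A_minus_Diag:
  assumes z: "z \<in> sign_vecs n" and v: "v \<in> carrier_vec n"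
  shows "vec_one_norm v \<le> \<eta> * vec_one_norm ((A - Diag z) *\<^sub>v v)" (is "_ \<le> \<eta> * vec_one_norm ?w")
proof -
  have dims: "dim_vec (A *\<^sub>v v) = n" "dim_vec ?w = n" "dim_vec v = n"
    using A v A_minus_Diag_carrier[OF z] by auto
  have "\<bar>(A *\<^sub>v v) $ i\<bar> \<le> \<bar>?w $ i\<bar> + \<bar>v $ i\<bar>" if "i < n" for i
    using A_minus_Diag_index[OF z v that] sign_vecs_index[OF z that] by auto
  hence "vec_one_norm (A *\<^sub>v v) \<le> vec_one_norm ?w + vec_one_norm v"
    unfolding vec_one_norm_def dims sum.distrib[symmetric] by (intro sum_mono) auto
  hence "\<gamma> * vec_one_norm (A *\<^sub>v v) \<le> \<gamma> * (vec_one_norm ?w + vec_one_norm v)"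
    using \<gamma>_pos by simp
  with vec_one_norm_le[OF v] have "vec_one_norm v \<le> \<gamma> * (vec_one_norm ?w + vec_one_norm v)"
    by linarith
  thus ?thesis using \<gamma>_less by (simp add: \<eta>_def field_simps)
qed

lemma det_A_minus_Diag:
  assumes z: "z \<in> sign_vecs n"
  shows "det (A - Diag z) \<noteq> 0"
proof
  assume "det (A - Diag z) = 0"
  then obtain v where v: "v \<in> carrier_vec n" "v \<noteq> 0\<^sub>v n" "(A - Diag z) *\<^sub>v v = 0\<^sub>v n"
    using det_0_iff_vec_prod_zero[OF A_minus_Diag_carrier[OF z]] by auto
  have "vec_one_norm (0\<^sub>v n) = 0" by (simp add: vec_one_norm_def)
  with vec_one_norm_le_A_minus_Diag[OF z v(1)] v(3) vec_one_norm_nonneg[of v]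
  have "vec_one_norm v = 0" by simp
  with vec_one_norm_zeroD[OF this v(1)] v(2) show False by simp
qed

lemma sf_H_carrier: "z \<in> sign_vecs n \<Longrightarrow> sf_H A z \<in> carrier_mat n n"
  unfolding sf_H_def by (rule mat_inv(1)[OF A_minus_Diag_carrier det_A_minus_Diag])

lemma sf_x_carrier: "z \<in> sign_vecs n \<Longrightarrow> x z \<in> carrier_vec n"
  unfolding sf_x_def using mult_mat_vec_carrier[OF sf_H_carrier b] .

lemma sf_F_eq: "F z = z \<bullet> x z"
  by (simp add: sf_F_def sf_x_def sf_H_def)

lemma sf_H_inverse:
  assumes "z \<in> sign_vecs n" "v \<in> carrier_vec n"
  shows "(A - Diag z) *\<^sub>v (sf_H A z *\<^sub>v v) = v" "sf_H A z *\<^sub>v ((A - Diag z) *\<^sub>v v) = v"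
  unfolding sf_H_def
  using mult_mat_inv_vec[OF A_minus_Diag_carrier det_A_minus_Diag] assms by auto

lemma sf_x_solves: "z \<in> sign_vecs n \<Longrightarrow> (A - Diag z) *\<^sub>v x z = b"
  unfolding sf_x_def by (rule sf_H_inverse(1)[OF _ b])

lemma sf_x_solves_index:
  assumes "z \<in> sign_vecs n" "i < n"
  shows "(A *\<^sub>v x z) $ i - z $ i * x z $ i = b $ i"
  using A_minus_Diag_index[OF assms(1) sf_x_carrier[OF assms(1)] assms(2)] sf_x_solves[OF assms(1)]
  by simp

lemma vec_one_norm_sf_H_le:
  assumes "z \<in> sign_vecs n" "v \<in> carrier_vec n"
  shows "vec_one_norm (sf_H A z *\<^sub>v v) \<le> \<eta> * vec_one_norm v"
  using vec_one_norm_le_A_minus_Diag[OF assms(1), of "sf_H A z *\<^sub>v v"]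
    sf_H_inverse(1)[OF assms] sf_H_carrier[OF assms(1)] assms(2) by auto

text \<open>Entry \<open>i\<close> of \<open>y z\<close> pairs column \<open>i\<close> of
  \<open>sf_H A z\<close> with signs, so it is bounded by the 1-norm of that column, the image of a
  unit vector.\<close>

lemma abs_sf_y_le:
  assumes z: "z \<in> sign_vecs n" and i: "i < n"
  shows "\<bar>y z $ i\<bar> \<le> \<eta>"
proof -
  note H = sf_H_carrier[OF z]
  have "y z $ i = (\<Sum>j<n. sf_H A z $$ (j, i) * z $ j)"
    unfolding sf_y_def using H i sign_vecs_carrier[OF z]
    by (subst index_mult_mat_vec_sum[of _ n n]) auto
  also have "\<bar>\<dots>\<bar> \<le> (\<Sum>j<n. \<bar>sf_H A z $$ (j, i)\<bar>)"
    by (intro order.trans[OF sum_abs] sum_mono) (simp add: abs_mult sign_vecs_abs_index[OF z])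
  also have "\<dots> = vec_one_norm (sf_H A z *\<^sub>v unit_vec n i)"
    unfolding vec_one_norm_def using H i by (intro sum.cong) auto
  also have "\<dots> \<le> \<eta> * vec_one_norm (unit_vec n i)"
    by (rule vec_one_norm_sf_H_le[OF z]) simp
  also have "vec_one_norm (unit_vec n i) = (\<Sum>j<n. if j = i then 1 else 0)"
    unfolding vec_one_norm_def by (intro sum.cong) (auto simp: i)
  also have "\<dots> = 1" using i by simp
  finally show ?thesis by simp
qed

section \<open>The gain identity for \<open>F\<close> and its two estimates\<close>

lemma sf_x_diff:
  assumes z: "z \<in> sign_vecs n" and w: "w \<in> sign_vecs n"
  shows "x w - x z = sf_H A w *\<^sub>v vec n (\<lambda>i. (w $ i - z $ i) * x z $ i)"
proof -
  note xc = sf_x_carrier[OF z] sf_x_carrier[OF w]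
  let ?d = "vec n (\<lambda>i. (w $ i - z $ i) * x z $ i)"
  \<comment> \<open>The resolvent identity applied to \<open>b\<close>: \<open>A - Diag w\<close>
    sends \<open>x w\<close> to \<open>b\<close> and \<open>x z\<close> to
    \<open>b - ?d\<close>.\<close>
  have "(A - Diag w) *\<^sub>v (x w - x z) = ?d"
  proof (rule eq_vecI)
    fix i assume "i < dim_vec ?d"
    hence i: "i < n" by simp
    show "((A - Diag w) *\<^sub>v (x w - x z)) $ i = ?d $ i"
      using xc i A sf_x_solves_index[OF z i] sf_x_solves_index[OF w i]
      by (simp add: A_minus_Diag_index[OF w _ i] mult_minus_distrib_mat_vec[OF A] algebra_simps
          del: index_mult_mat_vec)
  qed (use carrier_matD[OF A_minus_Diag_carrier[OF w]] in \<open>simp del: index_minus_mat\<close>)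
  thus ?thesis using sf_H_inverse(2)[OF w, of "x w - x z"] xc by simp
qed

text \<open>Transposing \<open>sf_H A w\<close> moves the change of \<open>x\<close> onto
  \<open>y w\<close>. The weights \<open>1 + y w $ i\<close> are positive, so a changed coordinate
  contributes positively exactly when it is a mismatch of \<open>z\<close>.\<close>

lemma sf_F_diff:
  assumes z: "z \<in> sign_vecs n" and w: "w \<in> sign_vecs n"
  shows "F w - F z = (\<Sum>i<n. (1 + y w $ i) * ((w $ i - z $ i) * x z $ i))"
proof -
  let ?d = "vec n (\<lambda>i. (w $ i - z $ i) * x z $ i)"
  note c = sf_x_carrier[OF z] sf_x_carrier[OF w] sign_vecs_carrier[OF z] sign_vecs_carrier[OF w]
  have "F w - F z = w \<bullet> (x w - x z) + (w - z) \<bullet> x z"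
    using c by (simp add: sf_F_eq scalar_prod_minus_distrib minus_scalar_prod_distrib)
  also have "w \<bullet> (x w - x z) = y w \<bullet> ?d"
    unfolding sf_x_diff[OF z w] sf_y_def
    using transpose_vec_mult_scalar[OF sf_H_carrier[OF w], of ?d w] c by simp
  also have "\<dots> = (\<Sum>i<n. y w $ i * ((w $ i - z $ i) * x z $ i))"
    by (auto simp: scalar_prod_def lessThan_atLeast0)
  also have "(w - z) \<bullet> x z = (\<Sum>i<n. (w $ i - z $ i) * x z $ i)"
    using c by (auto simp: scalar_prod_def lessThan_atLeast0)
  finally show ?thesis by (simp add: algebra_simps sum.distrib sum_subtractf)
qed

lemma mismatch_subset: "z \<in> sign_vecs n \<Longrightarrow> V z \<subseteq> {..<n}"
  by (auto simp: mismatch_def dest: sign_vecs_carrier)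

lemma finite_mismatch: "finite (V z)"
  by (simp add: mismatch_def)

text \<open>A flipped mismatch contributes \<open>2 * \<bar>x z $ i\<bar>\<close> with weight at
  least \<open>1 - \<eta>\<close>; all other summands of \<open>sf_F_diff\<close> vanish.\<close>

lemma sf_F_flip_ge:
  assumes z: "z \<in> sign_vecs n" and S: "S \<subseteq> V z"
  shows "2 * (1 - \<eta>) * (\<Sum>i\<in>S. \<bar>x z $ i\<bar>) \<le> F (flip S z) - F z"
proof -
  note w = flip_sign_vecs[OF z, of S]
  have Sn: "S \<subseteq> {..<n}" using S mismatch_subset[OF z] by auto
  have "2 * (1 - \<eta>) * (\<Sum>i\<in>S. \<bar>x z $ i\<bar>) = (\<Sum>i<n. if i \<in> S then (1 - \<eta>) * (2 * \<bar>x z $ i\<bar>) else 0)"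
    using Sn by (simp add: sum.If_cases Int_absorb1 flip: sum_distrib_left)
  also have "\<dots> \<le> (\<Sum>i<n. (1 + y (flip S z) $ i) * ((flip S z $ i - z $ i) * x z $ i))"
  proof (rule sum_mono)
    fix i assume "i \<in> {..<n}"
    hence i: "i < n" by simp
    show "(if i \<in> S then (1 - \<eta>) * (2 * \<bar>x z $ i\<bar>) else 0) \<le>
       (1 + y (flip S z) $ i) * ((flip S z $ i - z $ i) * x z $ i)"
    proof (cases "i \<in> S")
      case True
      hence "z $ i * x z $ i < 0" using S by (auto simp: mismatch_def)
      hence "(flip S z $ i - z $ i) * x z $ i = 2 * \<bar>x z $ i\<bar>"
        using sign_vecs_index[OF z i] flip_index[OF sign_vecs_carrier[OF z] i, of S] True by auto
      moreover have "1 - \<eta> \<le> 1 + y (flip S z) $ i" using abs_sf_y_le[OF w i] by linarith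
      ultimately show ?thesis using True by (simp only: if_True) (intro mult_right_mono, auto)
    qed (simp add: flip_index[OF sign_vecs_carrier[OF z] i])
  qed
  also have "\<dots> = F (flip S z) - F z" by (rule sf_F_diff[OF z w, symmetric])
  finally show ?thesis .
qed

text \<open>Outside the mismatch set no summand of \<open>sf_F_diff\<close> is positive; inside it
  the weight is at most \<open>1 + \<eta>\<close>.\<close>

lemma sf_F_diff_le:
  assumes z: "z \<in> sign_vecs n" and w: "w \<in> sign_vecs n"
  shows "F w - F z \<le> 2 * (1 + \<eta>) * (\<Sum>i\<in>V z. \<bar>x z $ i\<bar>)"
proof -
  have "F w - F z = (\<Sum>i<n. (1 + y w $ i) * ((w $ i - z $ i) * x z $ i))"
    by (rule sf_F_diff[OF z w])
  also have "\<dots> \<le> (\<Sum>i<n. if i \<in> V z then (1 + \<eta>) * (2 * \<bar>x z $ i\<bar>) else 0)"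
  proof (rule sum_mono)
    fix i assume "i \<in> {..<n}"
    hence i: "i < n" by simp
    have y1: "1 + y w $ i \<le> 1 + \<eta>" "0 \<le> 1 + y w $ i"
      using abs_sf_y_le[OF w i] \<eta>_bounds by linarith+
    show "(1 + y w $ i) * ((w $ i - z $ i) * x z $ i) \<le>
       (if i \<in> V z then (1 + \<eta>) * (2 * \<bar>x z $ i\<bar>) else 0)"
    proof (cases "i \<in> V z")
      case True
      have "(w $ i - z $ i) * x z $ i \<le> 2 * \<bar>x z $ i\<bar>"
        using sign_vecs_index[OF z i] sign_vecs_index[OF w i] by auto
      hence "(1 + y w $ i) * ((w $ i - z $ i) * x z $ i) \<le> (1 + y w $ i) * (2 * \<bar>x z $ i\<bar>)"
        using y1 by (intro mult_left_mono)
      also have "\<dots> \<le> (1 + \<eta>) * (2 * \<bar>x z $ i\<bar>)" using y1 by (intro mult_right_mono) auto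
      finally show ?thesis using True by simp
    next
      case False
      hence "0 \<le> z $ i * x z $ i" using i sign_vecs_carrier[OF z] by (auto simp: mismatch_def)
      hence "(w $ i - z $ i) * x z $ i \<le> 0"
        using sign_vecs_index[OF z i] sign_vecs_index[OF w i] by auto
      thus ?thesis using False y1 by (simp add: mult_nonneg_nonpos)
    qed
  qed
  also have "\<dots> = 2 * (1 + \<eta>) * (\<Sum>i\<in>V z. \<bar>x z $ i\<bar>)"
    using mismatch_subset[OF z]
    by (simp add: sum.If_cases Int_absorb1 flip: sum_distrib_left)
  finally show ?thesis .
qed

section \<open>Empty mismatch sets: global optimality and unique solvability\<close>

lemma mismatch_empty_imp_global_max:
  "z \<in> sign_vecs n \<Longrightarrow> V z = {} \<Longrightarrow> is_global_max n F z"
  \<comment> \<open>The bound on the optimality gap is now an empty sum.\<close>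
  using sf_F_diff_le[of z] by (auto simp: is_global_max_def)

text \<open>Without mismatches \<open>z $ i * x z $ i\<close> is the modulus of
  \<open>x z $ i\<close>, so the linear system for \<open>x z\<close> is the absolute value
  equation.\<close>

lemma mismatch_empty_imp_solution:
  assumes z: "z \<in> sign_vecs n" and V: "V z = {}"
  shows "ave_solution A b (x z)"
proof -
  have "A *\<^sub>v x z - map_vec abs (x z) = b"
  proof (rule eq_vecI)
    fix i assume "i < dim_vec b"
    hence i: "i < n" using b by simp
    have "\<not> z $ i * x z $ i < 0" using V i sign_vecs_carrier[OF z] by (auto simp: mismatch_def)
    hence "\<bar>x z $ i\<bar> = z $ i * x z $ i" using sign_vecs_index[OF z i] by auto
    thus "(A *\<^sub>v x z - map_vec abs (x z)) $ i = b $ i"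
      using sf_x_solves_index[OF z i] i A sf_x_carrier[OF z] by (simp del: index_mult_mat_vec)
  qed (use b sf_x_carrier[OF z] in simp)
  thus ?thesis using sf_x_carrier[OF z] A by (simp add: ave_solution_def)
qed

text \<open>By the reverse triangle inequality \<open>A\<close> does not increase the 1-norm of the
  difference of two solutions, while \<open>vec_one_norm_le\<close> with \<gamma> below 1 lets this
  happen only for the zero vector.\<close>

lemma ave_solution_unique:
  assumes u: "ave_solution A b u" and v: "ave_solution A b v"
  shows "u = v"
proof -
  have c: "u \<in> carrier_vec n" "v \<in> carrier_vec n"
    using u v A by (auto simp: ave_solution_def)
  have "\<bar>(A *\<^sub>v (u - v)) $ i\<bar> \<le> \<bar>(u - v) $ i\<bar>" if i: "i < n" for i
  proof -
    have "(A *\<^sub>v w) $ i = b $ i + \<bar>w $ i\<bar>" if "ave_solution A b w" "w \<in> carrier_vec n" for w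
    proof -
      have "(A *\<^sub>v w - map_vec abs w) $ i = b $ i" using that by (simp add: ave_solution_def)
      thus ?thesis using i that(2) A by (simp del: index_mult_mat_vec)
    qed
    from this[OF u c(1)] this[OF v c(2)] show ?thesis using i A c
      by (simp add: mult_minus_distrib_mat_vec[OF A] del: index_mult_mat_vec)
  qed
  hence "vec_one_norm (A *\<^sub>v (u - v)) \<le> vec_one_norm (u - v)"
    unfolding vec_one_norm_def using A c by (auto intro!: sum_mono simp del: index_mult_mat_vec)
  hence "vec_one_norm (u - v) \<le> \<gamma> * vec_one_norm (u - v)"
    using vec_one_norm_le[of "u - v"] c \<gamma>_pos
    by (meson minus_carrier_vec mult_left_mono less_imp_le order.trans)
  hence "(1 - \<gamma>) * vec_one_norm (u - v) \<le> 0" by (simp add: algebra_simps)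
  hence "vec_one_norm (u - v) = 0"
    using \<gamma>_less vec_one_norm_nonneg[of "u - v"] by (simp add: mult_le_0_iff)
  hence "u - v = 0\<^sub>v n" by (rule vec_one_norm_zeroD) (use c in simp)
  show ?thesis
  proof (rule eq_vecI)
    fix i assume "i < dim_vec v"
    thus "u $ i = v $ i" using arg_cong[OF \<open>u - v = 0\<^sub>v n\<close>, of "\<lambda>w. w $ i"] c by simp
  qed (use c in simp)
qed

section \<open>The exact effect of a single flip\<close>

lemma sf_x_flip_single:
  assumes z: "z \<in> sign_vecs n" and k: "k < n"
  shows "x (flip {k} z) $ k * (1 + 2 * z $ k * sf_H A z $$ (k, k)) = x z $ k"
proof -
  let ?w = "flip {k} z"
  note w = flip_sign_vecs[OF z, of "{k}"]
  let ?d = "vec n (\<lambda>i. (z $ i - ?w $ i) * x ?w $ i)"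
  \<comment> \<open>Going from the flipped vector back to \<open>z\<close> brings in
    \<open>sf_H\<close> at \<open>z\<close>, as in \<open>delta_F\<close>. The result is the
    Sherman-Morrison update, kept free of division.\<close>
  have "x z $ k - x ?w $ k = (sf_H A z *\<^sub>v ?d) $ k"
    using arg_cong[OF sf_x_diff[OF w z], of "\<lambda>v. v $ k"] k sf_x_carrier[OF w] sf_x_carrier[OF z]
    by (simp del: index_mult_mat_vec)
  also have "\<dots> = (\<Sum>j<n. if j = k then sf_H A z $$ (k, k) * (2 * z $ k * x ?w $ k) else 0)"
    unfolding index_mult_mat_vec_sum[OF sf_H_carrier[OF z] vec_carrier k]
    using sign_vecs_carrier[OF z] by (intro sum.cong) (auto simp: flip_index)
  also have "\<dots> = sf_H A z $$ (k, k) * (2 * z $ k * x ?w $ k)" using k by simp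
  finally show ?thesis by (simp add: algebra_simps)
qed

text \<open>Justifies the closed formula behind the steepest rule. The gain identity is used from
  the flipped vector back to \<open>z\<close>, so that \<open>y\<close> is taken at
  \<open>z\<close>.\<close>

lemma delta_F_eq:
  assumes z: "z \<in> sign_vecs n" and k: "k \<in> V z"
  shows "delta_F A b z k = F (flip {k} z) - F z"
proof -
  let ?w = "flip {k} z" and ?q = "1 + 2 * z $ k * sf_H A z $$ (k, k)"
  have kn: "k < n" using k mismatch_subset[OF z] by auto
  have nz: "x z $ k \<noteq> 0" using k by (auto simp: mismatch_def)
  note eq = sf_x_flip_single[OF z kn]
  \<comment> \<open>At a mismatch \<open>x z $ k\<close> is nonzero, and it has \<open>?q\<close> as
    a factor.\<close>
  have q: "?q \<noteq> 0" using eq nz by auto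
  have xw: "x ?w $ k = x z $ k / ?q" unfolding eq[symmetric] using q by simp
  have "F z - F ?w = (\<Sum>i<n. (1 + y z $ i) * ((z $ i - ?w $ i) * x ?w $ i))"
    by (rule sf_F_diff[OF flip_sign_vecs[OF z] z])
  also have "\<dots> = (\<Sum>i<n. if i = k then (1 + y z $ k) * (2 * z $ k * x ?w $ k) else 0)"
    using sign_vecs_carrier[OF z] by (intro sum.cong) (auto simp: flip_index)
  also have "\<dots> = (1 + y z $ k) * (2 * z $ k * x ?w $ k)" using kn by simp
  finally show ?thesis by (simp add: delta_F_def xw mult_ac)
qed

section \<open>Progress in one iteration and existence of a next step\<close>

lemma flip_stepD:
  assumes "flip_step rule A b z z'" "z \<in> sign_vecs n"
  shows "z' \<in> sign_vecs n" "V z \<noteq> {}"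
  using assms by (auto simp: flip_step_def flip_sign_vecs)

text \<open>Holds for every selection rule and meets the lower bound on nonzero entries in
  \<open>flip_steps_bound\<close>.\<close>

lemma flip_step_ge_min:
  assumes z: "z \<in> sign_vecs n" and step: "flip_step rule A b z z'"
  shows "\<exists>i<n. x z $ i \<noteq> 0 \<and> 2 * (1 - \<eta>) * \<bar>x z $ i\<bar> \<le> F z' - F z"
proof -
  obtain S i where S: "S \<subseteq> V z" "z' = flip S z" "i \<in> S"
    using step by (auto simp: flip_step_def)
  have "\<bar>x z $ i\<bar> \<le> (\<Sum>i\<in>S. \<bar>x z $ i\<bar>)"
    using S finite_subset[OF S(1) finite_mismatch] by (intro member_le_sum) auto
  hence "2 * (1 - \<eta>) * \<bar>x z $ i\<bar> \<le> 2 * (1 - \<eta>) * (\<Sum>i\<in>S. \<bar>x z $ i\<bar>)"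
    using \<eta>_bounds by (intro mult_left_mono) auto
  also have "\<dots> \<le> F z' - F z" using sf_F_flip_ge[OF z S(1)] S(2) by simp
  finally have "2 * (1 - \<eta>) * \<bar>x z $ i\<bar> \<le> F z' - F z" .
  moreover have "x z $ i \<noteq> 0" "i < n"
    using S mismatch_subset[OF z] by (auto simp: mismatch_def)
  ultimately show ?thesis by blast
qed

lemma full_flip_progress:
  assumes z: "z \<in> sign_vecs n" and step: "flip_step full_flip A b z z'"
  shows "2 * (1 - \<eta>) * (\<Sum>i\<in>V z. \<bar>x z $ i\<bar>) \<le> F z' - F z"
  using step sf_F_flip_ge[OF z] by (auto simp: flip_step_def full_flip_def)

lemma flip_single_ge:
  assumes z: "z \<in> sign_vecs n" and i: "i \<in> V z"
  shows "2 * (1 - \<eta>) * \<bar>x z $ i\<bar> \<le> F (flip {i} z) - F z"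
  using sf_F_flip_ge[OF z, of "{i}"] i by simp

text \<open>Both rules gain at least the guaranteed
  \<open>2 * (1 - \<eta>) * \<bar>x z $ i\<bar>\<close> of every mismatch \<open>i\<close>:
  Gauss-Southwell maximizes this guarantee, the steepest rule the gain itself. Summing over at most
  \<open>n\<close> mismatches costs the factor \<open>n\<close>.\<close>

lemma single_flip_progress:
  assumes z: "z \<in> sign_vecs n" and rule: "rule \<in> {gauss_southwell, steepest}"
    and step: "flip_step rule A b z z'"
  shows "2 * (1 - \<eta>) * (\<Sum>i\<in>V z. \<bar>x z $ i\<bar>) \<le> real n * (F z' - F z)"
proof -
  have each: "2 * (1 - \<eta>) * \<bar>x z $ i\<bar> \<le> F z' - F z" if i: "i \<in> V z" for i
    using rule
  proof (elim insertE emptyE)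
    assume "rule = gauss_southwell"
    with step obtain k where k: "k \<in> V z" "z' = flip {k} z" "\<bar>x z $ i\<bar> \<le> \<bar>x z $ k\<bar>"
      using i by (auto simp: flip_step_def gauss_southwell_def is_arg_max_linorder)
    have "2 * (1 - \<eta>) * \<bar>x z $ i\<bar> \<le> 2 * (1 - \<eta>) * \<bar>x z $ k\<bar>"
      using k(3) \<eta>_bounds by (intro mult_left_mono) auto
    with flip_single_ge[OF z k(1)] k(2) show ?thesis by simp
  next
    assume "rule = steepest"
    with step obtain k where k: "k \<in> V z" "z' = flip {k} z" "delta_F A b z i \<le> delta_F A b z k"
      using i by (auto simp: flip_step_def steepest_def is_arg_max_linorder)
    with flip_single_ge[OF z i] show ?thesis
      by (simp add: delta_F_eq[OF z i] delta_F_eq[OF z k(1)])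
  qed
  obtain i where i: "i \<in> V z" using flip_stepD[OF step z] by auto
  have nonneg: "0 \<le> F z' - F z"
    using each[OF i] \<eta>_bounds by (intro order.trans[OF _ each[OF i]] mult_nonneg_nonneg) auto
  have "2 * (1 - \<eta>) * (\<Sum>i\<in>V z. \<bar>x z $ i\<bar>) = (\<Sum>i\<in>V z. 2 * (1 - \<eta>) * \<bar>x z $ i\<bar>)"
    by (simp add: sum_distrib_left)
  also have "\<dots> \<le> (\<Sum>i\<in>V z. F z' - F z)" using each by (intro sum_mono)
  also have "\<dots> = real (card (V z)) * (F z' - F z)" by simp
  also have "\<dots> \<le> real n * (F z' - F z)"
    using nonneg card_mono[OF _ mismatch_subset[OF z]] by (intro mult_right_mono) auto
  finally show ?thesis .
qed

text \<open>\<open>terminates_within\<close> forbids getting stuck; the single-flip rules find their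
  index because the mismatch set is finite and nonempty.\<close>

lemma flip_step_exists:
  assumes V: "V z \<noteq> {}" and rule: "rule \<in> {full_flip, gauss_southwell, steepest}"
  shows "\<exists>z'. flip_step rule A b z z'"
proof -
  have arg_max: "\<exists>k\<in>V z. is_arg_max f (\<lambda>i. i \<in> V z) k" for f :: "nat \<Rightarrow> real"
  proof -
    have "Max (f ` V z) \<in> f ` V z" using finite_mismatch V by (intro Max_in) auto
    then obtain k where "k \<in> V z" "f k = Max (f ` V z)" by auto
    thus ?thesis using finite_mismatch[of z]
      by (intro bexI[of _ k]) (auto simp: is_arg_max_linorder)
  qed
  show ?thesis using rule
  proof (elim insertE emptyE)
    assume "rule = full_flip"
    thus ?thesis using V by (auto simp: flip_step_def full_flip_def)
  next
    assume "rule = gauss_southwell"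
    moreover obtain k where "k \<in> V z" "is_arg_max (\<lambda>i. \<bar>x z $ i\<bar>) (\<lambda>i. i \<in> V z) k"
      using arg_max by blast
    ultimately show ?thesis
      unfolding flip_step_def gauss_southwell_def by (intro exI[of _ "flip {k} z"] exI[of _ "{k}"]) auto
  next
    assume "rule = steepest"
    moreover obtain k where "k \<in> V z" "is_arg_max (delta_F A b z) (\<lambda>i. i \<in> V z) k"
      using arg_max by blast
    ultimately show ?thesis
      unfolding flip_step_def steepest_def by (intro exI[of _ "flip {k} z"] exI[of _ "{k}"]) auto
  qed
qed

section \<open>Contraction of the gap and the number of iterations\<close>

lemma sf_F_gap_le:
  assumes z: "z \<in> sign_vecs n" and w: "w \<in> sign_vecs n"
  shows "F w - F z \<le> 2 * (1 + \<eta>) * vec_one_norm b"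
proof -
  have "(\<Sum>i\<in>V z. \<bar>x z $ i\<bar>) \<le> vec_one_norm (x z)"
    unfolding vec_one_norm_def using mismatch_subset[OF z] sf_x_carrier[OF z]
    by (intro sum_mono2) auto
  also have "\<dots> \<le> \<eta> * vec_one_norm b"
    unfolding sf_x_def by (rule vec_one_norm_sf_H_le[OF z b])
  \<comment> \<open>Dropping \<eta> is harmless: the initial gap will enter only through its
    logarithm.\<close>
  also have "\<dots> \<le> 1 * vec_one_norm b"
    using \<eta>_bounds by (intro mult_right_mono vec_one_norm_nonneg) auto
  finally have "2 * (1 + \<eta>) * (\<Sum>i\<in>V z. \<bar>x z $ i\<bar>) \<le> 2 * (1 + \<eta>) * vec_one_norm b"
    using \<eta>_bounds by (intro mult_left_mono) auto
  with sf_F_diff_le[OF z w] show ?thesis by linarith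
qed

text \<open>The ratio of the gain constant to the gap constant, which becomes the contraction
  rate.\<close>

lemma one_minus_eta: "1 - \<eta> = (1 - 2 * \<gamma>) * (1 + \<eta>)"
  using \<gamma>_less by (simp add: \<eta>_def field_simps)

text \<open>Comparing with every sign vector \<open>w\<close> avoids naming a maximizer;
  \<open>flip_steps_bound\<close> takes the next iterate for \<open>w\<close>.\<close>

lemma flip_steps_contract:
  assumes z0: "z0 \<in> sign_vecs n" and m: "1 \<le> m"
    and progress: "\<And>z z'. z \<in> sign_vecs n \<Longrightarrow> flip_step rule A b z z' \<Longrightarrow>
      2 * (1 - \<eta>) * (\<Sum>i\<in>V z. \<bar>x z $ i\<bar>) \<le> m * (F z' - F z)"
  shows "(flip_step rule A b ^^ k) z0 z \<Longrightarrow> z \<in> sign_vecs n \<and>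
    (\<forall>w\<in>sign_vecs n. F w - F z \<le> (1 - (1 - 2 * \<gamma>) / m) ^ k * (F w - F z0))"
proof (induction k arbitrary: z)
  case 0
  thus ?case using z0 by simp
next
  case (Suc k z')
  then obtain z where k: "(flip_step rule A b ^^ k) z0 z" and step: "flip_step rule A b z z'"
    by auto
  let ?c = "1 - 2 * \<gamma>" and ?\<rho> = "1 - (1 - 2 * \<gamma>) / m"
  note IH = Suc.IH[OF k]
  hence z: "z \<in> sign_vecs n" by simp
  have "F w - F z' \<le> ?\<rho> ^ Suc k * (F w - F z0)" if w: "w \<in> sign_vecs n" for w
  proof -
    have "?c * (F w - F z) \<le> ?c * (2 * (1 + \<eta>) * (\<Sum>i\<in>V z. \<bar>x z $ i\<bar>))"
      using sf_F_diff_le[OF z w] \<gamma>_less by (intro mult_left_mono) auto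
    also have "\<dots> = 2 * (1 - \<eta>) * (\<Sum>i\<in>V z. \<bar>x z $ i\<bar>)" by (simp add: one_minus_eta)
    also have "\<dots> \<le> m * (F z' - F z)" by (rule progress[OF z step])
    finally have "?c / m * (F w - F z) \<le> F z' - F z" using m by (simp add: field_simps)
    hence "F w - F z' \<le> ?\<rho> * (F w - F z)" by (simp add: algebra_simps)
    \<comment> \<open>\<open>?\<rho>\<close> is nonnegative because \<open>m\<close> is at least 1
      and \<gamma> is positive, so the step also covers negative gaps.\<close>
    also have "\<dots> \<le> ?\<rho> * (?\<rho> ^ k * (F w - F z0))"
      using IH w m \<gamma>_pos by (intro mult_left_mono) auto
    finally show ?thesis by (simp add: mult.assoc)
  qed
  thus ?case using flip_stepD(1)[OF step z] by blast
qed

text \<open>The step after \<open>k\<close> iterations gains at least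
  \<open>2 * (1 - \<eta>) / D\<close>, yet no more than what \<open>k\<close> contractions leave of
  the initial gap. Rationality of the data will enter only through \<open>D\<close>.\<close>

lemma flip_steps_bound:
  assumes z0: "z0 \<in> sign_vecs n" and m: "1 \<le> m"
    and progress: "\<And>z z'. z \<in> sign_vecs n \<Longrightarrow> flip_step rule A b z z' \<Longrightarrow>
      2 * (1 - \<eta>) * (\<Sum>i\<in>V z. \<bar>x z $ i\<bar>) \<le> m * (F z' - F z)"
    and D: "0 < D" and granular: "\<And>z i. z \<in> sign_vecs n \<Longrightarrow> i < n \<Longrightarrow> x z $ i \<noteq> 0 \<Longrightarrow> 1 \<le> D * \<bar>x z $ i\<bar>"
    and steps: "(flip_step rule A b ^^ Suc k) z0 z'"
  shows "0 < vec_one_norm b"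
    and "real k * (1 - 2 * \<gamma>) / m \<le> ln (D * vec_one_norm b / (1 - 2 * \<gamma>))"
proof -
  let ?c = "1 - 2 * \<gamma>"
  have c: "0 < ?c" using \<gamma>_less by simp
  obtain z where k: "(flip_step rule A b ^^ k) z0 z" and step: "flip_step rule A b z z'"
    using steps by auto
  note contract = flip_steps_contract[OF z0 m progress k]
  hence z: "z \<in> sign_vecs n" by simp
  note z' = flip_stepD(1)[OF step z]
  obtain i where i: "i < n" "x z $ i \<noteq> 0" "2 * (1 - \<eta>) * \<bar>x z $ i\<bar> \<le> F z' - F z"
    using flip_step_ge_min[OF z step] by auto
  have "2 * (1 - \<eta>) \<le> 2 * (1 - \<eta>) * (D * \<bar>x z $ i\<bar>)"
    using granular[OF z i(1,2)] \<eta>_bounds by simp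
  also have "\<dots> \<le> D * (F z' - F z)"
    using mult_left_mono[OF i(3), of D] D by (simp add: mult_ac)
  also have "\<dots> \<le> D * ((1 - ?c / m) ^ k * (F z' - F z0))"
    using contract z' D by (intro mult_left_mono) auto
  also have "\<dots> \<le> D * ((1 - ?c / m) ^ k * (2 * (1 + \<eta>) * vec_one_norm b))"
    using sf_F_gap_le[OF z0 z'] D m \<gamma>_pos by (intro mult_left_mono) auto
  finally have "2 * (?c * (1 + \<eta>)) \<le> D * ((1 - ?c / m) ^ k * (2 * (1 + \<eta>) * vec_one_norm b))"
    unfolding one_minus_eta .
  hence "(2 * (1 + \<eta>)) * ?c \<le> (2 * (1 + \<eta>)) * (D * ((1 - ?c / m) ^ k * vec_one_norm b))"
    by (simp only: mult_ac)
  hence 1: "?c \<le> D * vec_one_norm b * (1 - ?c / m) ^ k"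
    using \<eta>_bounds by (subst (asm) mult_le_cancel_left_pos) (auto simp: mult_ac)
  \<comment> \<open>A completed step excludes \<open>b = 0\<close>, which makes the logarithm below
    meaningful.\<close>
  with c show pos: "0 < vec_one_norm b"
    using vec_one_norm_nonneg[of b] by (cases "vec_one_norm b = 0") auto
  \<comment> \<open>The inequality \<open>1 - t \<le> exp (- t)\<close> turns the rate into an
    exponential.\<close>
  have "(1 - ?c / m) ^ k \<le> exp (- (?c / m)) ^ k"
    using exp_ge_add_one_self[of "- (?c / m)"] m \<gamma>_pos by (intro power_mono) auto
  also have "\<dots> = exp (- (real k * ?c / m))" by (simp add: exp_of_nat_mult[symmetric])
  finally have "D * vec_one_norm b * (1 - ?c / m) ^ k \<le> D * vec_one_norm b * exp (- (real k * ?c / m))"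
    using D pos by (intro mult_left_mono) auto
  with 1 have "?c \<le> D * vec_one_norm b * exp (- (real k * ?c / m))" by linarith
  hence "exp (real k * ?c / m) \<le> D * vec_one_norm b / ?c"
    using c by (simp add: exp_minus field_simps)
  thus "real k * ?c / m \<le> ln (D * vec_one_norm b / ?c)"
    using c D pos by (subst ln_ge_iff) auto
qed

lemma terminates_withinI:
  assumes z0: "z0 \<in> sign_vecs n" and rule: "rule \<in> {full_flip, gauss_southwell, steepest}"
    and bound: "\<And>k z. (flip_step rule A b ^^ k) z0 z \<Longrightarrow> real k \<le> N"
    and P: "\<And>z. z \<in> sign_vecs n \<Longrightarrow> V z = {} \<Longrightarrow> P z"
  shows "terminates_within rule A b z0 N P"
proof -
  have "z \<in> sign_vecs n" if "(flip_step rule A b ^^ k) z0 z" for k z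
    using that
  proof (induction k arbitrary: z)
    case (Suc k)
    thus ?case using flip_stepD(1) by auto
  qed (use z0 in simp)
  thus ?thesis
    unfolding terminates_within_def using bound P flip_step_exists[OF _ rule] by auto
qed

end

section \<open>Determinant bounds and integer linear systems\<close>

lemma abs_det_le:
  fixes M :: "'a :: linordered_idom mat"
  assumes M: "M \<in> carrier_mat n n" and B: "\<And>i j. i < n \<Longrightarrow> j < n \<Longrightarrow> \<bar>M $$ (i, j)\<bar> \<le> B"
  shows "\<bar>det M\<bar> \<le> fact n * B ^ n"
proof -
  \<comment> \<open>The Leibniz formula has \<open>fact n\<close> terms. This crude bound suffices,
    as only its logarithm matters.\<close>
  have "\<bar>det M\<bar> \<le> (\<Sum>p | p permutes {0..<n}. \<bar>signof p * (\<Prod>i = 0..<n. M $$ (i, p i))\<bar>)"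
    unfolding det_def'[OF M] by (rule sum_abs)
  also have "\<dots> \<le> (\<Sum>p | p permutes {0..<n}. B ^ n)"
  proof (rule sum_mono)
    fix p assume "p \<in> {p. p permutes {0..<n}}"
    hence p: "p permutes {0..<n}" by simp
    have "\<bar>signof p * (\<Prod>i = 0..<n. M $$ (i, p i))\<bar> = (\<Prod>i = 0..<n. \<bar>M $$ (i, p i)\<bar>)"
      by (simp add: abs_mult abs_prod sign_def)
    also have "\<dots> \<le> (\<Prod>i = 0..<n. B)"
      using permutes_in_image[OF p] by (intro prod_mono) (auto intro!: B)
    finally show "\<bar>signof p * (\<Prod>i = 0..<n. M $$ (i, p i))\<bar> \<le> B ^ n" by simp
  qed
  also have "\<dots> = fact n * B ^ n" by (simp add: card_permutations)
  finally show ?thesis .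
qed

lemma smult_mat_mult_vec:
  fixes M :: "'a :: comm_semiring_0 mat"
  assumes "M \<in> carrier_mat nr nc" "v \<in> carrier_vec nc"
  shows "(k \<cdot>\<^sub>m M) *\<^sub>v v = k \<cdot>\<^sub>v (M *\<^sub>v v)"
  using assms by (intro eq_vecI) (auto simp: scalar_prod_def sum_distrib_left mult.assoc)

text \<open>Cramer's rule in adjugate form: \<open>det M\<close> times \<open>v\<close> equals
  \<open>adj_mat M\<close> applied to \<open>u\<close>, an integer vector, and a nonzero integer has
  modulus at least 1.\<close>

lemma integer_system_solution_granular:
  fixes M :: "int mat" and u :: "int vec" and v :: "real vec"
  assumes M: "M \<in> carrier_mat n n" and u: "u \<in> carrier_vec n" and v: "v \<in> carrier_vec n"
    and det: "det M \<noteq> 0"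
    and eq: "map_mat of_int M *\<^sub>v v = map_vec of_int u"
    and i: "i < n" "v $ i \<noteq> 0"
  shows "1 \<le> \<bar>of_int (det M)\<bar> * \<bar>v $ i\<bar>"
proof -
  let ?h = "of_int :: int \<Rightarrow> real"
  note adj = adj_mat[OF M]
  have "map_mat ?h (adj_mat M) *\<^sub>v (map_mat ?h M *\<^sub>v v) = map_mat ?h (adj_mat M * M) *\<^sub>v v"
    unfolding of_int_hom.mat_hom_mult[OF adj(1) M]
    using adj(1) M v by (intro assoc_mult_mat_vec[symmetric]) auto
  also have "map_mat ?h (adj_mat M * M) = ?h (det M) \<cdot>\<^sub>m 1\<^sub>m n"
    unfolding adj(3) by (intro eq_matI) auto
  also have "\<dots> *\<^sub>v v = ?h (det M) \<cdot>\<^sub>v v"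
    using v by (simp add: smult_mat_mult_vec[of _ n n])
  finally have "?h (det M) \<cdot>\<^sub>v v = map_vec ?h (adj_mat M *\<^sub>v u)"
    by (simp add: eq of_int_hom.mult_mat_vec_hom[OF adj(1) u])
  from arg_cong[OF this, of "\<lambda>w. w $ i"]
  have *: "?h (det M) * v $ i = ?h ((adj_mat M *\<^sub>v u) $ i)"
    using i v adj(1) by (simp del: index_mult_mat_vec)
  with det i have "(adj_mat M *\<^sub>v u) $ i \<noteq> 0" by auto
  hence "1 \<le> \<bar>?h ((adj_mat M *\<^sub>v u) $ i)\<bar>" by linarith
  thus ?thesis unfolding *[symmetric] by (simp add: abs_mult)
qed

section \<open>Rational data: granularity of the iterates\<close>

locale rational_ave_small_inverse = ave_small_inverse +
  fixes Abar :: "int mat" and bbar :: "int vec" and dA db L :: int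
  assumes Abar: "Abar \<in> carrier_mat n n" and bbar: "bbar \<in> carrier_vec n"
    and dA: "0 < dA" and db: "0 < db"
    and A_eq: "A = (1 / real_of_int dA) \<cdot>\<^sub>m map_mat real_of_int Abar"
    and b_eq: "b = (1 / real_of_int db) \<cdot>\<^sub>v map_vec real_of_int bbar"
    and dA_le: "dA \<le> L" and db_le: "db \<le> L"
    and Abar_le: "\<And>i j. i < n \<Longrightarrow> j < n \<Longrightarrow> \<bar>Abar $$ (i, j)\<bar> \<le> L"
    and bbar_le: "\<And>i. i < n \<Longrightarrow> \<bar>bbar $ i\<bar> \<le> L"
begin

lemma sf_x_granular:
  assumes z: "z \<in> sign_vecs n" and i: "i < n" "x z $ i \<noteq> 0"
  shows "1 \<le> (real_of_int L * (fact n * (2 * real_of_int L) ^ n)) * \<bar>x z $ i\<bar>"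
proof -
  \<comment> \<open>The integer version of \<open>A - Diag z\<close> scaled by \<open>dA\<close>;
    the conditional recovers the real sign \<open>z $ i\<close> as an integer. With it,
    \<open>db\<close> times \<open>x z\<close> solves a system with right-hand side
    \<open>dA\<close> times \<open>bbar\<close>.\<close>
  define M where "M = Abar - mat_diag n (\<lambda>i. dA * (if z $ i = 1 then 1 else -1))"
  have M: "M \<in> carrier_mat n n" unfolding M_def by (intro minus_carrier_mat mat_diag_dim)
  have M_eq: "map_mat real_of_int M = real_of_int dA \<cdot>\<^sub>m (A - Diag z)"
  proof (rule eq_matI)
    fix i j assume "i < dim_row (real_of_int dA \<cdot>\<^sub>m (A - Diag z))" "j < dim_col (real_of_int dA \<cdot>\<^sub>m (A - Diag z))"
    hence ij: "i < n" "j < n" using sign_vecs_carrier[OF z] by (auto simp: Diag_def mat_diag_def)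
    have "real_of_int (if z $ i = 1 then 1 else -1) = z $ i" using sign_vecs_index[OF z ij(1)] by auto
    thus "map_mat real_of_int M $$ (i, j) = (real_of_int dA \<cdot>\<^sub>m (A - Diag z)) $$ (i, j)"
      using ij dA Abar sign_vecs_carrier[OF z]
      by (auto simp: M_def A_eq Diag_def mat_diag_def field_simps)
  qed (use M sign_vecs_carrier[OF z] in \<open>auto simp: Diag_def mat_diag_def\<close>)
  have "real_of_int (det M) = real_of_int dA ^ n * det (A - Diag z)"
    using of_int_hom.hom_det[of M, where ?'a = real] carrier_matD(2)[OF A_minus_Diag_carrier[OF z]]
    by (simp add: M_eq del: of_int_hom.hom_det index_minus_mat)
  hence det: "det M \<noteq> 0" using det_A_minus_Diag[OF z] dA by auto
  have "map_mat real_of_int M *\<^sub>v (real_of_int db \<cdot>\<^sub>v x z)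
      = (real_of_int dA * real_of_int db) \<cdot>\<^sub>v ((A - Diag z) *\<^sub>v x z)"
    unfolding M_eq using A_minus_Diag_carrier[OF z] sf_x_carrier[OF z]
    by (simp add: smult_mat_mult_vec[of _ n n] mult_mat_vec[of _ n n] smult_smult_assoc mult.commute)
  also have "\<dots> = map_vec real_of_int (dA \<cdot>\<^sub>v bbar)"
    unfolding sf_x_solves[OF z] using db bbar by (auto simp: b_eq)
  finally have "1 \<le> \<bar>real_of_int (det M)\<bar> * \<bar>(real_of_int db \<cdot>\<^sub>v x z) $ i\<bar>"
    using sf_x_carrier[OF z] bbar i db
    by (intro integer_system_solution_granular[OF M _ _ det]) auto
  also have "\<dots> = real_of_int db * \<bar>real_of_int (det M)\<bar> * \<bar>x z $ i\<bar>"
    using sf_x_carrier[OF z] i db by (simp add: abs_mult)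
  \<comment> \<open>One \<open>L\<close> bounds the entry of \<open>Abar\<close>, the other the
    diagonal shift by \<open>dA\<close>.\<close>
  also have "\<bar>M $$ (i, j)\<bar> \<le> 2 * L" if ij: "i < n" "j < n" for i j
    using Abar_le[OF ij] dA_le dA ij Abar by (auto simp: M_def mat_diag_def)
  hence "\<bar>det M\<bar> \<le> fact n * (2 * L) ^ n" by (rule abs_det_le[OF M])
  hence "real_of_int \<bar>det M\<bar> \<le> real_of_int (fact n * (2 * L) ^ n)" by (simp only: of_int_le_iff)
  hence "real_of_int db * \<bar>real_of_int (det M)\<bar> \<le> real_of_int L * (fact n * (2 * real_of_int L) ^ n)"
    using db db_le by (intro mult_mono) auto
  hence "real_of_int db * \<bar>real_of_int (det M)\<bar> * \<bar>x z $ i\<bar> \<le>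
    real_of_int L * (fact n * (2 * real_of_int L) ^ n) * \<bar>x z $ i\<bar>"
    by (intro mult_right_mono) auto
  finally show ?thesis .
qed

section \<open>Logarithmic estimates in terms of \<open>n\<close> and \<open>L\<close>\<close>

lemma L_pos: "1 \<le> L"
  using db db_le by simp

lemma vec_one_norm_b_le: "vec_one_norm b \<le> real n * real_of_int L"
proof -
  have "\<bar>b $ i\<bar> \<le> real_of_int L" if i: "i < n" for i
  proof -
    have "real_of_int \<bar>bbar $ i\<bar> \<le> real_of_int L" using bbar_le[OF i] by (simp only: of_int_le_iff)
    moreover have "real_of_int L * 1 \<le> real_of_int L * real_of_int db"
      using db L_pos by (intro mult_left_mono) auto
    ultimately have "\<bar>real_of_int (bbar $ i)\<bar> \<le> real_of_int L * real_of_int db" by simp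
    thus ?thesis using db bbar i by (simp add: b_eq abs_mult field_simps)
  qed
  hence "vec_one_norm b \<le> (\<Sum>i<n. real_of_int L)"
    unfolding vec_one_norm_def carrier_vecD[OF b] by (intro sum_mono) auto
  thus ?thesis by simp
qed

text \<open>This keeps the logarithm in the iteration bound away from 0.\<close>

lemma n_L_ge_3: "3 \<le> real n * real_of_int L"
proof -
  let ?e = "unit_vec n 0 :: real vec"
  have "\<bar>A $$ (i, 0)\<bar> \<le> real_of_int L" if i: "i < n" for i
  proof -
    have "real_of_int \<bar>Abar $$ (i, 0)\<bar> \<le> real_of_int L"
      using Abar_le[OF i n_pos] by (simp only: of_int_le_iff)
    moreover have "real_of_int L * 1 \<le> real_of_int L * real_of_int dA"
      using dA L_pos by (intro mult_left_mono) auto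
    ultimately have "\<bar>real_of_int (Abar $$ (i, 0))\<bar> \<le> real_of_int L * real_of_int dA" by simp
    thus ?thesis using dA Abar i n_pos by (simp add: A_eq abs_mult field_simps)
  qed
  hence "(\<Sum>i<n. \<bar>A $$ (i, 0)\<bar>) \<le> (\<Sum>i<n. real_of_int L)" by (intro sum_mono) auto
  hence *: "vec_one_norm (A *\<^sub>v ?e) \<le> real n * real_of_int L"
    using A n_pos by (simp add: vec_one_norm_def)
  have "1 \<le> vec_one_norm ?e"
    using member_le_sum[of 0 "{..<n}" "\<lambda>i. \<bar>?e $ i\<bar>"] n_pos by (simp add: vec_one_norm_def)
  also have "\<dots> \<le> \<gamma> * vec_one_norm (A *\<^sub>v ?e)" by (rule vec_one_norm_le) simp
  also have "\<dots> \<le> \<gamma> * (real n * real_of_int L)" using * \<gamma>_pos by simp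
  also have "\<dots> < 1 / 2 * (real n * real_of_int L)"
    using \<gamma>_less n_pos L_pos by (intro mult_strict_right_mono) auto
  \<comment> \<open>Strictness comes from \<gamma> below 1/2; integrality then lifts the bound to 3,
    which exceeds \<open>exp 1\<close>.\<close>
  finally have "real_of_int 2 < real_of_int (int n * L)" by simp
  hence "3 \<le> int n * L" by linarith
  hence "real_of_int 3 \<le> real_of_int (int n * L)" by (simp only: of_int_le_iff)
  thus ?thesis by simp
qed

lemma ln_n_L_ge_1: "1 \<le> ln (real n * real_of_int L)"
  using n_L_ge_3 exp_le by (subst ln_ge_iff) linarith+

text \<open>With \<open>fact n \<le> n ^ n\<close> everything is bounded by
  \<open>?P ^ 2 * (2 * ?P) ^ n\<close>. The factor 4 is 2 from the square and 2 from absorbing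
  \<open>ln 2\<close> into \<open>ln ?P\<close>.\<close>

lemma ln_gap_ratio_le:
  assumes pos: "0 < vec_one_norm b"
  shows "ln (real_of_int L * (fact n * (2 * real_of_int L) ^ n) * vec_one_norm b / (1 - 2 * \<gamma>))
    \<le> ln (1 / (1 - 2 * \<gamma>)) + 4 * real n * ln (real n * real_of_int L)"
proof -
  let ?c = "1 - 2 * \<gamma>" and ?L = "real_of_int L" and ?P = "real n * real_of_int L"
  have c: "0 < ?c" using \<gamma>_less by simp
  have L: "0 < ?L" using L_pos by simp
  have n1: "1 \<le> real n" using n_pos by simp
  have P: "0 < ?P" using n_L_ge_3 by simp
  have "?L * (fact n * (2 * ?L) ^ n) * vec_one_norm b \<le> ?P * ((real n ^ n) * (2 * ?L) ^ n) * ?P"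
    using L n1 vec_one_norm_b_le pos fact_le_power[of n, where ?'a = real]
    by (intro mult_mono) (auto intro!: mult_mono)
  also have "\<dots> = ?P ^ 2 * (2 * ?P) ^ n"
    by (simp add: power2_eq_square power_mult_distrib mult_ac)
  finally have "?L * (fact n * (2 * ?L) ^ n) * vec_one_norm b / ?c \<le> 1 / ?c * (?P ^ 2 * (2 * ?P) ^ n)"
    using c by (simp add: divide_right_mono)
  moreover have "0 < ?L * (fact n * (2 * ?L) ^ n) * vec_one_norm b / ?c" using c L pos by simp
  ultimately have "ln (?L * (fact n * (2 * ?L) ^ n) * vec_one_norm b / ?c) \<le> ln (1 / ?c * (?P ^ 2 * (2 * ?P) ^ n))"
    by (subst ln_le_cancel_iff) linarith+
  also have "\<dots> = ln (1 / ?c) + (2 * ln ?P + real n * (ln 2 + ln ?P))"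
    using c P by (simp only: ln_mult_pos ln_realpow zero_less_power zero_less_divide_1_iff
        zero_less_numeral mult_pos_pos of_nat_numeral)
  also have "2 * ln ?P \<le> 2 * (real n * ln ?P)"
    using n1 ln_n_L_ge_1 by simp
  also have "real n * (ln 2 + ln ?P) \<le> real n * (2 * ln ?P)"
    using ln_n_L_ge_1 ln_2_less_1 by (intro mult_left_mono) auto
  finally show ?thesis by simp
qed

text \<open>The summand 1 pays for the iteration that \<open>flip_steps_bound\<close> leaves
  uncounted. Since \<open>real n * ln (real n * real_of_int L)\<close> is at least 1, it absorbs the
  additive \<open>ln (1 / (1 - 2 * \<gamma>))\<close>.\<close>

lemma iteration_bound:
  assumes z0: "z0 \<in> sign_vecs n" and m: "1 \<le> m"
    and progress: "\<And>z z'. z \<in> sign_vecs n \<Longrightarrow> flip_step rule A b z z' \<Longrightarrow>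
      2 * (1 - \<eta>) * (\<Sum>i\<in>V z. \<bar>x z $ i\<bar>) \<le> m * (F z' - F z)"
    and steps: "(flip_step rule A b ^^ k) z0 z"
  shows "real k \<le> (1 + (ln (1 / (1 - 2 * \<gamma>)) + 4) / (1 - 2 * \<gamma>)) *
    (m * (real n * ln (real n * real_of_int L)))"
proof -
  let ?c = "1 - 2 * \<gamma>" and ?\<Lambda> = "ln (real n * real_of_int L)"
  let ?D = "real_of_int L * (fact n * (2 * real_of_int L) ^ n)"
  have c: "0 < ?c" using \<gamma>_less by simp
  have lnc: "0 \<le> ln (1 / ?c)" using c \<gamma>_pos by (intro ln_ge_zero) (simp add: field_simps)
  have n\<Lambda>: "1 \<le> real n * ?\<Lambda>"
    using mult_mono[of 1 "real n" 1 ?\<Lambda>] n_pos ln_n_L_ge_1 by simp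
  have mn\<Lambda>: "1 \<le> m * (real n * ?\<Lambda>)"
    using mult_mono[of 1 m 1 "real n * ?\<Lambda>"] m n\<Lambda> by simp
  show ?thesis
  proof (cases k)
    case 0
    thus ?thesis using c lnc mn\<Lambda> by simp
  next
    case (Suc l)
    have D: "0 < ?D" using L_pos by simp
    note bound = flip_steps_bound[OF z0 m progress D sf_x_granular steps[unfolded Suc]]
    have "real l * ?c / m \<le> ln (1 / ?c) + 4 * real n * ?\<Lambda>"
      using bound ln_gap_ratio_le by (meson order.trans)
    also have "ln (1 / ?c) \<le> ln (1 / ?c) * (real n * ?\<Lambda>)"
      using mult_left_mono[OF n\<Lambda> lnc] by simp
    finally have "real l * ?c / m \<le> (ln (1 / ?c) + 4) * (real n * ?\<Lambda>)" by (simp add: algebra_simps)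
    hence "real l \<le> (ln (1 / ?c) + 4) / ?c * (m * (real n * ?\<Lambda>))"
      using c m by (simp add: field_simps)
    thus ?thesis using mn\<Lambda> Suc by (simp add: distrib_right)
  qed
qed

end

section \<open>Both iteration bounds with a common constant\<close>

theorem corollary3p13:
  fixes \<gamma> :: real
  assumes "\<gamma> < 1 / 2"
  shows "\<exists>C::real. \<forall>(n::nat) (A::real mat) (b::real vec)
      (Abar::int mat) (bbar::int vec) (dA::int) (db::int) (L::int).
    n \<ge> 1 \<and>
    A \<in> carrier_mat n n \<and> b \<in> carrier_vec n \<and>
    invertible_mat A \<and> mat_one_norm (mat_inv A) \<le> \<gamma> \<and>
    Abar \<in> carrier_mat n n \<and> bbar \<in> carrier_vec n \<and> dA > 0 \<and> db > 0 \<and>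
    A = (1 / real_of_int dA) \<cdot>\<^sub>m map_mat real_of_int Abar \<and>
    b = (1 / real_of_int db) \<cdot>\<^sub>v map_vec real_of_int bbar \<and>
    L = Max {db, dA, vec_inf_norm bbar, mat_max_norm Abar}
    \<longrightarrow>
    (\<forall>z0 \<in> sign_vecs n.
       terminates_within full_flip A b z0 (C * (real n * ln (real n * real_of_int L)))
         (\<lambda>z. ave_solution A b (sf_x A b z) \<and>
              (\<forall>x. ave_solution A b x \<longrightarrow> x = sf_x A b z))) \<and>
    (\<forall>rule \<in> {gauss_southwell, steepest}. \<forall>z0 \<in> sign_vecs n.
       terminates_within rule A b z0 (C * (real n ^ 2 * ln (real n * real_of_int L)))
         (is_global_max n (sf_F A b)))"
proof -
  \<comment> \<open>The constant of \<open>iteration_bound\<close>, depending on \<gamma> alone; it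
    serves \<open>m = 1\<close> for full flips and \<open>m = n\<close> for single flips.\<close>
  define C where "C = 1 + (ln (1 / (1 - 2 * \<gamma>)) + 4) / (1 - 2 * \<gamma>)"
  show ?thesis
  proof (intro exI[of _ C] allI impI, elim conjE)
    fix n :: nat and A :: "real mat" and b :: "real vec" and Abar :: "int mat"
      and bbar :: "int vec" and dA db L :: int
    assume n: "n \<ge> 1" and A: "A \<in> carrier_mat n n" "invertible_mat A" "mat_one_norm (mat_inv A) \<le> \<gamma>"
      and b: "b \<in> carrier_vec n" and Abar: "Abar \<in> carrier_mat n n" and bbar: "bbar \<in> carrier_vec n"
      and d: "dA > 0" "db > 0"
      and eqs: "A = (1 / real_of_int dA) \<cdot>\<^sub>m map_mat real_of_int Abar"
        "b = (1 / real_of_int db) \<cdot>\<^sub>v map_vec real_of_int bbar"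
      and L: "L = Max {db, dA, vec_inf_norm bbar, mat_max_norm Abar}"
    have L_ge: "db \<le> L" "dA \<le> L" "vec_inf_norm bbar \<le> L" "mat_max_norm Abar \<le> L"
      unfolding L by (intro Max_ge; simp)+
    have "\<bar>Abar $$ (i, j)\<bar> \<le> L" if "i < n" "j < n" for i j
      using that Abar by (rule_tac order.trans[OF Max_ge L_ge(4)[unfolded mat_max_norm_def]]) auto
    moreover have "\<bar>bbar $ i\<bar> \<le> L" if "i < n" for i
      using that bbar by (rule_tac order.trans[OF Max_ge L_ge(3)[unfolded vec_inf_norm_def]]) auto
    ultimately interpret rational_ave_small_inverse n A b \<gamma> Abar bbar dA db L
      using n A b Abar bbar d eqs L_ge assms by unfold_locales auto
    show "(\<forall>z0 \<in> sign_vecs n.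
       terminates_within full_flip A b z0 (C * (real n * ln (real n * real_of_int L)))
         (\<lambda>z. ave_solution A b (sf_x A b z) \<and>
              (\<forall>x. ave_solution A b x \<longrightarrow> x = sf_x A b z))) \<and>
    (\<forall>rule \<in> {gauss_southwell, steepest}. \<forall>z0 \<in> sign_vecs n.
       terminates_within rule A b z0 (C * (real n ^ 2 * ln (real n * real_of_int L)))
         (is_global_max n (sf_F A b)))"
    proof (intro conjI ballI)
      fix z0 assume z0: "z0 \<in> sign_vecs n"
      show "terminates_within full_flip A b z0 (C * (real n * ln (real n * real_of_int L)))
         (\<lambda>z. ave_solution A b (sf_x A b z) \<and>
              (\<forall>x. ave_solution A b x \<longrightarrow> x = sf_x A b z))"
      proof (rule terminates_withinI[OF z0])
        fix k z assume "(flip_step full_flip A b ^^ k) z0 z"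
        from iteration_bound[OF z0 _ _ this, of 1] full_flip_progress
        show "real k \<le> C * (real n * ln (real n * real_of_int L))"
          by (simp add: C_def)
      qed (use mismatch_empty_imp_solution ave_solution_unique in auto)
    next
      fix rule z0 assume rule: "rule \<in> {gauss_southwell, steepest}" and z0: "z0 \<in> sign_vecs n"
      show "terminates_within rule A b z0 (C * (real n ^ 2 * ln (real n * real_of_int L)))
         (is_global_max n (sf_F A b))"
      proof (rule terminates_withinI[OF z0])
        fix k z assume "(flip_step rule A b ^^ k) z0 z"
        from iteration_bound[OF z0 _ single_flip_progress[OF _ rule] this]
        show "real k \<le> C * (real n ^ 2 * ln (real n * real_of_int L))"
          using n by (simp add: C_def power2_eq_square mult.assoc)
      qed (use rule mismatch_empty_imp_global_max in auto)
    qed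
  qed
qed

end
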